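(* If $X$ is any uniform space then $\mathbf{M}_{u\sigma}(X) = \mathbf{M}_u(eX)$.
   Context: All linear spaces are over $\mathbb{R}$. All uniform spaces are assumed Hausdorff and are described by their uniformly continuous pseudometrics (abbreviated u.c.p.). For a pseudometric $d$ on a set $X$, let $$\mathrm{Lip}(d) = \{ f : X \to \mathbb{R} \mid |f(x)| \le 1 \text{ and } |f(x)-f(x')| \le d(x,x') \text{ for all } x,x' \in X \},$$ considered with the topology of pointwise convergence on $X$ (as a subspace of $\mathbb{R}^X$). For a uniform space $X$, $\mathbf{U_b}(X)$ is the space of bounded uniformly continuous functions $f : X \to \mathbb{R}$ with the norm $\|f\| = \sup\{|f(x)| \mid x \in X\}$. $\mathbf{M}(X)$ is the norm dual of $\mathbf{U_b}(X)$. $\mathbf{M}_u(X)$ (the space of uniform measures on $X$) is the space of those $\mu \in \mathbf{M}(X)$ whose restriction to $\mathrm{Lip}(d)$ is continuous (in the topology of pointwise convergence on $X$) for every u.c.p. $d$ on $X$. $\mathbf{M}_{u\sigma}(X)$ is the space of those $\mu \in \mathbf{M}(X)$ that are sequentially continuous on $\mathrm{Lip}(d)$ for each u.c.p. $d$ on $X$; that is, $\lim_n \mu(f_n) = 0$ whenever $d$ is a u.c.p. on $X$, $f_n \in \mathrm{Lip}(d)$ for $n = 1,2,\ldots$, and $\lim_n f_n(x) = 0$ for each $x \in X$. $eX$ denotes the separable modification (cardinal reflection $X_{\aleph_1}$) of $X$: the uniform space on the same set as $X$ such that a pseudometric on $X$ is a u.c.p. on $eX$ if and only if it is a separable u.c.p.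 on $X$ (a pseudometric being separable if its topology has a countable dense subset). One has $\mathbf{U_b}(X) = \mathbf{U_b}(eX)$ and $\mathbf{M}(X) = \mathbf{M}(eX)$, so both sides of the claimed equality are subspaces of the same space. *)

theory Defs
  imports "HOL-Analysis.Analysis"
begin

text \<open>
  A uniform structure on the type \<open>'a\<close> is represented by its filter of entourages
  \<open>U :: ('a \<times> 'a) filter\<close>; for a space \<open>'a :: uniform_space\<close> this is \<^const>\<open>uniformity\<close>.
  The structure is an explicit parameter because a space and its separable modification are two
  uniform structures on the same set.
\<close>

section \<open>Pseudometrics\<close>

definition pseudometric :: "('a \<Rightarrow> 'a \<Rightarrow> real) \<Rightarrow> bool" where
  "pseudometric d \<longleftrightarrow>
     (\<forall>x y. 0 \<le> d x y) \<and> (\<forall>x. d x x = 0) \<and> (\<forall>x y. d x y = d y x) \<and>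
     (\<forall>x y z. d x z \<le> d x y + d y z)"

definition pseudometric_topology :: "('a \<Rightarrow> 'a \<Rightarrow> real) \<Rightarrow> 'a topology" where
  "pseudometric_topology d = topology (\<lambda>S. \<forall>x\<in>S. \<exists>e>0. \<forall>y. d x y < e \<longrightarrow> y \<in> S)"

definition separable_pseudometric :: "('a \<Rightarrow> 'a \<Rightarrow> real) \<Rightarrow> bool" where
  "separable_pseudometric d \<longleftrightarrow> pseudometric d \<and> separable_space (pseudometric_topology d)"

text \<open>For a pseudometric, uniform continuity on the product space amounts to the sets
  \<open>{(x, y). d x y < e}\<close> being entourages; see \<open>ucp_uniformity_iff\<close> below.\<close>

definition ucp :: "('a \<times> 'a) filter \<Rightarrow> ('a \<Rightarrow> 'a \<Rightarrow> real) \<Rightarrow> bool" where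
  "ucp U d \<longleftrightarrow> pseudometric d \<and> (\<forall>e>0. eventually (\<lambda>(x, y). d x y < e) U)"

definition Lip :: "('a \<Rightarrow> 'a \<Rightarrow> real) \<Rightarrow> ('a \<Rightarrow> real) set" where
  "Lip d = {f. (\<forall>x. \<bar>f x\<bar> \<le> 1) \<and> (\<forall>x x'. \<bar>f x - f x'\<bar> \<le> d x x')}"

section \<open>Functionals on bounded uniformly continuous functions\<close>

definition Ub :: "('a \<times> 'a) filter \<Rightarrow> ('a \<Rightarrow> real) set" where
  "Ub U = {f. bounded (range f) \<and> filterlim (\<lambda>(x, y). (f x, f y)) uniformity U}"

definition sup_norm :: "('a \<Rightarrow> real) \<Rightarrow> real" where
  "sup_norm f = (SUP x. \<bar>f x\<bar>)"

text \<open>Functionals are defined on \<open>Ub U\<close> only; \<^const>\<open>extensional\<close> fixes a dummy value elsewhere,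
  so that equality of functionals is equality on \<open>Ub U\<close>.\<close>

definition M :: "('a \<times> 'a) filter \<Rightarrow> (('a \<Rightarrow> real) \<Rightarrow> real) set" where
  "M U = {\<mu> \<in> extensional (Ub U).
     (\<forall>f\<in>Ub U. \<forall>g\<in>Ub U. \<mu> (\<lambda>x. f x + g x) = \<mu> f + \<mu> g) \<and>
     (\<forall>c. \<forall>f\<in>Ub U. \<mu> (\<lambda>x. c * f x) = c * \<mu> f) \<and>
     (\<exists>K. \<forall>f\<in>Ub U. \<bar>\<mu> f\<bar> \<le> K * sup_norm f)}"

text \<open>The topology of type \<open>'a \<Rightarrow> real\<close> used by \<^const>\<open>continuous_on\<close> is the product topology,
  that is, pointwise convergence.\<close>

definition M_u :: "('a \<times> 'a) filter \<Rightarrow> (('a \<Rightarrow> real) \<Rightarrow> real) set" where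
  "M_u U = {\<mu> \<in> M U. \<forall>d. ucp U d \<longrightarrow> continuous_on (Lip d) \<mu>}"

definition M_u\<sigma> :: "('a \<times> 'a) filter \<Rightarrow> (('a \<Rightarrow> real) \<Rightarrow> real) set" where
  "M_u\<sigma> U = {\<mu> \<in> M U. \<forall>d f. ucp U d \<longrightarrow> (\<forall>n::nat. f n \<in> Lip d) \<longrightarrow>
     (\<forall>x. (\<lambda>n. f n x) \<longlonglongrightarrow> 0) \<longrightarrow> (\<lambda>n. \<mu> (f n)) \<longlonglongrightarrow> 0}"

section \<open>The separable modification\<close>

text \<open>The uniform structure generated by the separable uniformly continuous pseudometrics.
  Lemma \<open>ucp_separable_modification_iff\<close> below is its characteristic property.\<close>

definition separable_modification :: "('a \<times> 'a) filter \<Rightarrow> ('a \<times> 'a) filter" where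
  "separable_modification U =
     (INF (d, e) \<in> {(d, e). ucp U d \<and> separable_pseudometric d \<and> 0 < e}.
        principal {(x, y). d x y < e})"

section \<open>Facts relating the definitions to the usual formulations\<close>

lemma pseudometricD:
  assumes "pseudometric d"
  shows "0 \<le> d x y" "d x x = 0" "d x y = d y x" "d x z \<le> d x y + d y z"
  using assms unfolding pseudometric_def by blast+

lemma openin_pseudometric_topology:
  assumes "pseudometric d"
  shows "openin (pseudometric_topology d) S \<longleftrightarrow> (\<forall>x\<in>S. \<exists>e>0. \<forall>y. d x y < e \<longrightarrow> y \<in> S)"
proof -
  let ?P = "\<lambda>S. \<forall>x\<in>S. \<exists>e>0. \<forall>y. d x y < e \<longrightarrow> y \<in> S"
  have "?P (S \<inter> T)" if ST: "?P S" "?P T" for S T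
  proof
    fix x assume "x \<in> S \<inter> T"
    then obtain e1 e2 where "e1 > 0" "e2 > 0" "\<forall>y. d x y < e1 \<longrightarrow> y \<in> S" "\<forall>y. d x y < e2 \<longrightarrow> y \<in> T"
      using ST by blast
    then show "\<exists>e>0. \<forall>y. d x y < e \<longrightarrow> y \<in> S \<inter> T"
      by (intro exI[of _ "min e1 e2"]) auto
  qed
  moreover have "?P (\<Union>K)" if "\<forall>S\<in>K. ?P S" for K
    using that by (meson UnionE UnionI)
  ultimately have "istopology ?P"
    unfolding istopology_def by blast
  then show ?thesis
    by (simp add: pseudometric_topology_def topology_inverse')
qed

lemma topspace_pseudometric_topology:
  "pseudometric d \<Longrightarrow> topspace (pseudometric_topology d) = UNIV"
  using openin_pseudometric_topology[of d UNIV] openin_subset[of _ UNIV] by (auto intro: zero_less_one)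

lemma separable_pseudometric_iff:
  assumes d: "pseudometric d"
  shows "separable_pseudometric d \<longleftrightarrow> (\<exists>C. countable C \<and> (\<forall>x. \<forall>e>0. \<exists>c\<in>C. d x c < e))"
proof -
  have ball: "openin (pseudometric_topology d) {y. d x y < e}" for x e
    unfolding openin_pseudometric_topology[OF d]
  proof
    fix z assume z: "z \<in> {y. d x y < e}"
    show "\<exists>r>0. \<forall>y. d z y < r \<longrightarrow> y \<in> {y. d x y < e}"
    proof (intro exI[of _ "e - d x z"] conjI allI impI)
      show "y \<in> {y. d x y < e}" if "d z y < e - d x z" for y
        using that pseudometricD(4)[OF d, of x y z] by simp
    qed (use z in simp)
  qed
  have "pseudometric_topology d closure_of C = UNIV \<longleftrightarrow> (\<forall>x. \<forall>e>0. \<exists>c\<in>C. d x c < e)" for C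
  proof
    assume L: "pseudometric_topology d closure_of C = UNIV"
    show "\<forall>x. \<forall>e>0. \<exists>c\<in>C. d x c < e"
    proof (intro allI impI)
      fix x and e :: real assume "e > 0"
      have "x \<in> pseudometric_topology d closure_of C" "x \<in> {y. d x y < e}"
        using L \<open>e > 0\<close> pseudometricD(2)[OF d, of x] by simp_all
      then obtain c where "c \<in> C" "c \<in> {y. d x y < e}"
        using ball[of x e] unfolding in_closure_of by meson
      then show "\<exists>c\<in>C. d x c < e" by auto
    qed
  next
    assume R: "\<forall>x. \<forall>e>0. \<exists>c\<in>C. d x c < e"
    have "x \<in> pseudometric_topology d closure_of C" for x
      unfolding in_closure_of topspace_pseudometric_topology[OF d] openin_pseudometric_topology[OF d]
      using R by (meson UNIV_I)
    then show "pseudometric_topology d closure_of C = UNIV" by blast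
  qed
  then show ?thesis
    by (simp add: separable_pseudometric_def d separable_space_def topspace_pseudometric_topology)
qed

lemma pseudometric_add:
  assumes "pseudometric d1" "pseudometric d2"
  shows "pseudometric (\<lambda>x y. d1 x y + d2 x y)"
  unfolding pseudometric_def
proof (intro conjI allI)
  fix x y z
  show "0 \<le> d1 x y + d2 x y"
    using pseudometricD(1)[OF assms(1), of x y] pseudometricD(1)[OF assms(2), of x y] by linarith
  show "d1 x x + d2 x x = 0"
    using pseudometricD(2)[OF assms(1), of x] pseudometricD(2)[OF assms(2), of x] by linarith
  show "d1 x y + d2 x y = d1 y x + d2 y x"
    using pseudometricD(3)[OF assms(1), of x y] pseudometricD(3)[OF assms(2), of x y] by linarith
  show "d1 x z + d2 x z \<le> d1 x y + d2 x y + (d1 y z + d2 y z)"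
    using pseudometricD(4)[OF assms(1), of x z y] pseudometricD(4)[OF assms(2), of x z y] by linarith
qed

lemma separable_pseudometric_add:
  assumes "separable_pseudometric d1" "separable_pseudometric d2"
  shows "separable_pseudometric (\<lambda>x y. d1 x y + d2 x y)"
proof -
  have d: "pseudometric d1" "pseudometric d2"
    using assms by (auto simp: separable_pseudometric_def)
  obtain C1 C2 where C: "countable C1" "countable C2"
    "\<And>x e. e > 0 \<Longrightarrow> \<exists>c\<in>C1. d1 x c < e" "\<And>x e. e > 0 \<Longrightarrow> \<exists>c\<in>C2. d2 x c < e"
    using assms d by (auto simp: separable_pseudometric_iff)
  define p where "p = (\<lambda>(c1, c2, n::nat). SOME z. d1 z c1 < inverse (real (Suc n)) \<and> d2 z c2 < inverse (real (Suc n)))"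
  have "\<exists>c\<in>p ` (C1 \<times> C2 \<times> UNIV). d1 x c + d2 x c < e" if e: "e > 0" for x e
  proof -
    obtain n where n: "inverse (real (Suc n)) < e / 4"
      using reals_Archimedean[of "e / 4"] e by auto
    have "inverse (real (Suc n)) > 0" by simp
    with C obtain c1 c2 where c: "c1 \<in> C1" "c2 \<in> C2" "d1 x c1 < inverse (real (Suc n))" "d2 x c2 < inverse (real (Suc n))"
      by meson
    define z where "z = p (c1, c2, n)"
    have "d1 z c1 < inverse (real (Suc n)) \<and> d2 z c2 < inverse (real (Suc n))"
      unfolding z_def p_def prod.case by (rule someI[of _ x]) (use c in auto)
    then have "d1 x z + d2 x z < e"
      using n c pseudometricD(4)[OF d(1), of x z c1] pseudometricD(4)[OF d(2), of x z c2]
        pseudometricD(3)[OF d(1), of z c1] pseudometricD(3)[OF d(2), of z c2] by linarith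
    moreover have "z \<in> p ` (C1 \<times> C2 \<times> UNIV)"
      using c by (auto simp: z_def)
    ultimately show ?thesis by blast
  qed
  moreover have "countable (p ` (C1 \<times> C2 \<times> UNIV))"
    using C by auto
  ultimately show ?thesis
    unfolding separable_pseudometric_iff[OF pseudometric_add[OF d]] by blast
qed

lemma ucp_add:
  assumes "ucp U d1" "ucp U d2"
  shows "ucp U (\<lambda>x y. d1 x y + d2 x y)"
proof -
  have "eventually (\<lambda>(x, y). d1 x y + d2 x y < e) U" if "e > 0" for e
  proof -
    have "eventually (\<lambda>(x, y). d1 x y < e / 2) U" "eventually (\<lambda>(x, y). d2 x y < e / 2) U"
      using assms half_gt_zero[OF that] by (auto simp only: ucp_def)
    then show ?thesis by eventually_elim auto
  qed
  then show ?thesis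
    using assms by (simp add: ucp_def pseudometric_add)
qed

lemma eventually_separable_modification:
  "eventually P (separable_modification U) \<longleftrightarrow>
     (\<exists>d e. ucp U d \<and> separable_pseudometric d \<and> 0 < e \<and> (\<forall>x y. d x y < e \<longrightarrow> P (x, y)))"
proof -
  let ?B = "{(d, e::real). ucp U d \<and> separable_pseudometric d \<and> 0 < e}"
  have "pseudometric (\<lambda>x y :: 'a. 0)" by (simp add: pseudometric_def)
  then have "(\<lambda>x y. 0, 1) \<in> ?B"
    by (simp add: ucp_def separable_pseudometric_iff case_prod_unfold) (rule exI[of _ "{undefined}"], simp)
  then have ne: "?B \<noteq> {}" by blast
  have "\<exists>x\<in>?B. (\<lambda>(d, e). principal {(x, y). d x y < e}) x
      \<le> inf ((\<lambda>(d, e). principal {(x, y). d x y < e}) a) ((\<lambda>(d, e). principal {(x, y). d x y < e}) b)"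
    if ab: "a \<in> ?B" "b \<in> ?B" for a b
  proof -
    obtain d1 e1 d2 e2 where eq: "a = (d1, e1)" "b = (d2, e2)" by (metis surj_pair)
    have d: "ucp U d1" "ucp U d2" "separable_pseudometric d1" "separable_pseudometric d2" "0 < e1" "0 < e2"
      using ab eq by auto
    have nn: "0 \<le> d1 x y" "0 \<le> d2 x y" for x y
      using d by (auto simp: ucp_def pseudometric_def)
    have "d1 x y < e1 \<and> d2 x y < e2" if "d1 x y + d2 x y < min e1 e2" for x y
      using that nn[of x y] by linarith
    then show ?thesis
      using d by (intro bexI[of _ "(\<lambda>x y. d1 x y + d2 x y, min e1 e2)"])
        (auto simp: eq ucp_add separable_pseudometric_add)
  qed
  from eventually_INF_base[OF ne this, of P] show ?thesis
    unfolding separable_modification_def by (auto simp: eventually_principal)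
qed

lemma separable_modification_ge: "U \<le> separable_modification U"
  unfolding le_filter_def eventually_separable_modification
proof (intro allI impI)
  fix P assume "\<exists>d e. ucp U d \<and> separable_pseudometric d \<and> 0 < e \<and> (\<forall>x y. d x y < e \<longrightarrow> P (x, y))"
  then obtain d e where d: "ucp U d" "0 < e" "\<And>x y. d x y < e \<Longrightarrow> P (x, y)" by blast
  then have "eventually (\<lambda>(x, y). d x y < e) U" by (simp add: ucp_def)
  then show "eventually P U" by (rule eventually_mono) (use d in auto)
qed

lemma ucp_separable_modification_iff:
  "ucp (separable_modification U) d \<longleftrightarrow> ucp U d \<and> separable_pseudometric d"
proof
  assume L: "ucp (separable_modification U) d"
  then have pm: "pseudometric d" by (simp add: ucp_def)
  have "ucp U d"
    using L separable_modification_ge[of U] by (auto simp: ucp_def le_filter_def)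
  moreover have "separable_pseudometric d"
  proof -
    have "\<exists>C. countable C \<and> (\<forall>x. \<exists>c\<in>C. d x c < inverse (real (Suc n)))" for n
    proof -
      have "eventually (\<lambda>(x, y). d x y < inverse (real (Suc n))) (separable_modification U)"
        using L by (simp add: ucp_def)
      then obtain d' e where d': "separable_pseudometric d'" "0 < e"
          "\<And>x y. d' x y < e \<Longrightarrow> d x y < inverse (real (Suc n))"
        by (auto simp: eventually_separable_modification)
      moreover have "pseudometric d'" using d'(1) by (simp add: separable_pseudometric_def)
      ultimately show ?thesis by (metis separable_pseudometric_iff)
    qed
    then obtain C where C: "\<And>n. countable (C n)" "\<And>n x. \<exists>c\<in>C n. d x c < inverse (real (Suc n))"
      by metis
    have "\<exists>c\<in>(\<Union>n. C n). d x c < e" if "e > 0" for x e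
      using reals_Archimedean[OF that] C(2)[of _ x] by (meson UNIV_I UN_I less_trans)
    moreover have "countable (\<Union>n. C n)" using C(1) by blast
    ultimately show ?thesis
      unfolding separable_pseudometric_iff[OF pm] by blast
  qed
  ultimately show "ucp U d \<and> separable_pseudometric d" ..
next
  assume R: "ucp U d \<and> separable_pseudometric d"
  then have "pseudometric d" by (simp add: ucp_def)
  with R show "ucp (separable_modification U) d"
    by (auto simp: ucp_def[of "separable_modification U"] eventually_separable_modification)
qed

lemma uniform_space_separable_modification:
  "class.uniform_space
     (\<lambda>S. \<forall>x\<in>S. eventually (\<lambda>(x', y). x' = x \<longrightarrow> y \<in> S) (separable_modification U))
     (separable_modification U)"
proof
  fix E
  assume "eventually E (separable_modification U)"
  then obtain d e where d: "ucp U d" "separable_pseudometric d" "0 < e"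
      and E: "\<And>x y. d x y < e \<Longrightarrow> E (x, y)"
    by (auto simp: eventually_separable_modification)
  then have pm: "pseudometric d" by (simp add: ucp_def)
  show "E (x, x)" for x
    using E d(3) pseudometricD(2)[OF pm] by simp
  show "eventually (\<lambda>(x, y). E (y, x)) (separable_modification U)"
    unfolding eventually_separable_modification using d E pseudometricD(3)[OF pm]
    by (intro exI[of _ d] exI[of _ e]) auto
  have "d x z < e" if "d x y < e / 2" "d y z < e / 2" for x y z
    using that pseudometricD(4)[OF pm, of x z y] by linarith
  moreover have "eventually (\<lambda>(x, y). d x y < e / 2) (separable_modification U)"
    unfolding eventually_separable_modification using d
    by (intro exI[of _ d] exI[of _ "e / 2"]) auto
  ultimately show "\<exists>D. eventually D (separable_modification U) \<and>
      (\<forall>x y z. D (x, y) \<longrightarrow> D (y, z) \<longrightarrow> E (x, z))"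
    using E by (intro exI[of _ "\<lambda>(x, y). d x y < e / 2"]) auto
qed simp

lemma ucp_uniformity_iff:
  fixes d :: "'a::uniform_space \<Rightarrow> 'a \<Rightarrow> real"
  assumes d: "pseudometric d"
  shows "ucp uniformity d \<longleftrightarrow> uniformly_continuous_on UNIV (\<lambda>(x, y). d x y)"
proof
  assume L: "ucp uniformity d"
  show "uniformly_continuous_on UNIV (\<lambda>(x, y). d x y)"
    unfolding uniformly_continuous_on_uniformity filterlim_iff
  proof (intro allI impI)
    fix P :: "real \<times> real \<Rightarrow> bool" assume "eventually P uniformity"
    then obtain e where e: "e > 0" "\<And>a b. dist a b < e \<Longrightarrow> P (a, b)"
      unfolding eventually_uniformity_metric by blast
    have ev: "eventually (\<lambda>(x, y). d x y < e / 2) uniformity"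
      using L half_gt_zero[OF e(1)] by (auto simp only: ucp_def)
    have "P (d x y, d x' y')" if "d x x' < e / 2" "d y y' < e / 2" for x y x' y'
    proof (rule e(2))
      show "dist (d x y) (d x' y') < e"
        using that pseudometricD(4)[OF d, of x y x'] pseudometricD(4)[OF d, of x' y y']
          pseudometricD(4)[OF d, of x' y' x] pseudometricD(4)[OF d, of x y' y]
          pseudometricD(3)[OF d, of x x'] pseudometricD(3)[OF d, of y y']
        unfolding dist_real_def by linarith
    qed
    then show "\<forall>\<^sub>F x in uniformity_on UNIV. P (case x of (x, y) \<Rightarrow> (case x of (x, y) \<Rightarrow> d x y, case y of (x, y) \<Rightarrow> d x y))"
      using ev
      by (auto simp: uniformity_prod_def eventually_filtermap eventually_prod_filter case_prod_unfold
          intro!: exI[of _ "\<lambda>(x, y). d x y < e / 2"])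
  qed
next
  assume R: "uniformly_continuous_on UNIV (\<lambda>(x, y). d x y)"
  have "eventually (\<lambda>(x, y). d x y < e) uniformity" if e: "e > 0" for e
  proof -
    have "eventually (\<lambda>(a, b). dist a b < e) (uniformity :: (real \<times> real) filter)"
      unfolding eventually_uniformity_metric using e by auto
    from uniformly_continuous_onD[OF R this]
    obtain P Q where PQ: "eventually P (uniformity :: ('a \<times> 'a) filter)"
        "eventually Q (uniformity :: ('a \<times> 'a) filter)"
        and *: "\<And>x x' y y'. P (x, x') \<Longrightarrow> Q (y, y') \<Longrightarrow> dist (d x y) (d x' y') < e"
      by (fastforce simp: uniformity_prod_def eventually_filtermap eventually_prod_filter case_prod_unfold)
    have "d x y < e" if "P (x, y)" for x y
      using *[OF that, of y y] uniformity_refl[OF PQ(2), of y] pseudometricD(2)[OF d]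
        pseudometricD(1)[OF d, of x y] by (simp add: dist_real_def)
    then show ?thesis
      using PQ(1) by (auto elim: eventually_mono)
  qed
  then show "ucp uniformity d" by (simp add: ucp_def d)
qed

lemma Ub_uniformity:
  "Ub uniformity = {f. bounded (range f) \<and> uniformly_continuous_on UNIV f}"
  by (simp add: Ub_def uniformly_continuous_on_uniformity)

end

theory Submission
  imports Defs
begin

text \<open>
  Both inclusions compare sequential continuity with continuity on the sets \<open>Lip d\<close>, and each
  rests on an observation about separability. The two spaces of functionals live in the same dual
  space, because a bounded uniformly continuous \<open>f\<close> induces the pseudometric
  \<open>\<bar>f x - f y\<bar>\<close>, which is separable since \<open>\<real>\<close> is (\<open>Ub_separable_modification\<close>).

  If \<open>d\<close> is separable, then on the equicontinuous set \<open>Lip d\<close> pointwise convergence on the whole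
  space is the same as pointwise convergence on a countable \<open>d\<close>-dense set. Hence \<open>Lip d\<close> is first
  countable and sequential continuity there gives continuity
  (\<open>continuous_on_Lip_if_sequentially_continuous\<close>). By linearity, sequential continuity at \<open>0\<close> is
  enough. So every element of \<open>M_u\<sigma>\<close> belongs to \<open>M_u\<close> of the separable modification.

  Conversely, let \<open>f n \<in> Lip d\<close> converge to \<open>0\<close> pointwise, where \<open>d\<close> need not be separable. Then
  \<open>x \<mapsto> (f n x)\<^sub>n\<close> maps the space into the Banach space \<open>c\<^sub>0\<close> of null sequences, which is separable.
  The pullback of the norm metric is a separable pseudometric below \<open>d\<close>
  (\<open>separable_sup_diff\<close>) for which all \<open>f n\<close> are still \<open>1\<close>-Lipschitz, so continuity with
  respect to the separable modification already gives \<open>\<mu> (f n) \<longlonglongrightarrow> 0\<close>.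
\<close>

section \<open>The dual space of the separable modification\<close>

text \<open>A choice of one point for each code and each scale gives a countable dense set.\<close>

lemma separable_pseudometric_if_countable_codes:
  assumes d: "pseudometric d"
    and codes: "\<And>e. e > 0 \<Longrightarrow> \<exists>h :: 'a \<Rightarrow> 'b::countable. \<forall>x y. h x = h y \<longrightarrow> d x y < e"
  shows "separable_pseudometric d"
proof -
  have "\<forall>n. \<exists>h :: 'a \<Rightarrow> 'b. \<forall>x y. h x = h y \<longrightarrow> d x y < inverse (real (Suc n))"
    by (intro allI codes) (rule inverse_positive_iff_positive[THEN iffD2], simp)
  from choice[OF this] obtain h :: "nat \<Rightarrow> 'a \<Rightarrow> 'b"
    where h: "\<And>n x y. h n x = h n y \<Longrightarrow> d x y < inverse (real (Suc n))"
    by auto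
  define C where "C = (\<Union>n. range (\<lambda>b. inv (h n) b))"
  have "countable C"
    unfolding C_def by (intro countable_UN countable_image countableI_type)
  moreover have "\<exists>c\<in>C. d x c < e" if e: "e > 0" for x e
  proof -
    obtain n where n: "inverse (real (Suc n)) < e"
      using reals_Archimedean[OF e] by auto
    have "h n (inv (h n) (h n x)) = h n x"
      by (simp add: f_inv_into_f)
    then have "d x (inv (h n) (h n x)) < e"
      by (rule less_trans[OF h[OF sym] n])
    moreover have "inv (h n) (h n x) \<in> C"
      by (auto simp: C_def)
    ultimately show ?thesis ..
  qed
  ultimately show ?thesis
    unfolding separable_pseudometric_iff[OF d] by (intro exI[of _ C]) simp
qed

lemma abs_diff_less_if_floor_eq:
  fixes a b r :: real
  assumes "r > 0" "\<lfloor>a / r\<rfloor> = \<lfloor>b / r\<rfloor>"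
  shows "\<bar>a - b\<bar> < r"
proof -
  have "\<bar>a / r - b / r\<bar> < 1"
    using assms(2) by linarith
  then show ?thesis
    using assms(1) by (simp add: diff_divide_distrib[symmetric] abs_divide)
qed

lemma in_Ub_iff:
  "f \<in> Ub U \<longleftrightarrow> bounded (range f) \<and> (\<forall>e>0. eventually (\<lambda>(x, y). \<bar>f x - f y\<bar> < e) U)"
proof -
  have "filterlim (\<lambda>(x, y). (f x, f y)) uniformity U
      \<longleftrightarrow> (\<forall>e>0. eventually (\<lambda>(x, y). \<bar>f x - f y\<bar> < e) U)"
    unfolding uniformity_dist filterlim_INF filterlim_principal
    by (auto simp: case_prod_unfold dist_real_def)
  then show ?thesis
    by (simp add: Ub_def)
qed

lemma pseudometric_abs_diff: "pseudometric (\<lambda>x y. \<bar>f x - f y :: real\<bar>)"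
  by (auto simp: pseudometric_def)

lemma Ub_separable_modification: "Ub (separable_modification U) = Ub U"
proof (rule set_eqI)
  fix f :: "'a \<Rightarrow> real"
  have "separable_pseudometric (\<lambda>x y. \<bar>f x - f y\<bar>)"
  proof (rule separable_pseudometric_if_countable_codes[OF pseudometric_abs_diff])
    show "\<exists>h :: 'a \<Rightarrow> int. \<forall>x y. h x = h y \<longrightarrow> \<bar>f x - f y\<bar> < e" if "e > 0" for e
      using abs_diff_less_if_floor_eq[OF that] by (intro exI[of _ "\<lambda>x. \<lfloor>f x / e\<rfloor>"]) blast
  qed
  then have "ucp (separable_modification U) (\<lambda>x y. \<bar>f x - f y\<bar>) \<longleftrightarrow> ucp U (\<lambda>x y. \<bar>f x - f y\<bar>)"
    by (simp add: ucp_separable_modification_iff)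
  then show "f \<in> Ub (separable_modification U) \<longleftrightarrow> f \<in> Ub U"
    by (simp add: in_Ub_iff ucp_def pseudometric_abs_diff)
qed

lemma M_separable_modification: "M (separable_modification U) = M U"
  by (simp add: M_def Ub_separable_modification)

lemma Lip_subset_Ub:
  assumes "ucp U d"
  shows "Lip d \<subseteq> Ub U"
proof
  fix f assume f: "f \<in> Lip d"
  then have "bounded (range f)"
    by (auto simp: bounded_iff Lip_def intro!: exI[of _ 1])
  moreover have "eventually (\<lambda>(x, y). \<bar>f x - f y\<bar> < e) U" if "e > 0" for e
  proof -
    have "\<bar>f x - f y\<bar> \<le> d x y" for x y
      using f by (simp add: Lip_def)
    then have lip: "d x y < e \<Longrightarrow> \<bar>f x - f y\<bar> < e" for x y
      by (rule le_less_trans)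
    have "eventually (\<lambda>(x, y). d x y < e) U"
      using assms that by (simp add: ucp_def)
    then show ?thesis
      by (rule eventually_mono) (use lip in auto)
  qed
  ultimately show "f \<in> Ub U"
    by (simp add: in_Ub_iff)
qed

lemma M_scaled_diff:
  assumes "\<mu> \<in> M U" "f \<in> Ub U" "g \<in> Ub U"
  shows "\<mu> (\<lambda>x. c * (f x - g x)) = c * (\<mu> f - \<mu> g)"
proof -
  have scale: "(\<lambda>x. a * h x) \<in> Ub U" if "h \<in> Ub U" for a h
  proof -
    have "bounded (range (\<lambda>x. a * h x))"
      using bounded_scaling[of "range h" a] that by (simp add: in_Ub_iff image_image)
    moreover have "eventually (\<lambda>(x, y). \<bar>a * h x - a * h y\<bar> < e) U" if "e > 0" for e
    proof -
      have pos: "e / (\<bar>a\<bar> + 1) > 0"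
        using that by simp
      then have "eventually (\<lambda>(x, y). \<bar>h x - h y\<bar> < e / (\<bar>a\<bar> + 1)) U"
        using \<open>h \<in> Ub U\<close> unfolding in_Ub_iff by blast
      then show ?thesis
      proof (rule eventually_mono, clarify)
        fix x y assume *: "\<bar>h x - h y\<bar> < e / (\<bar>a\<bar> + 1)"
        have "\<bar>a * h x - a * h y\<bar> = \<bar>a\<bar> * \<bar>h x - h y\<bar>"
          by (simp add: right_diff_distrib[symmetric] abs_mult)
        also have "\<dots> \<le> (\<bar>a\<bar> + 1) * \<bar>h x - h y\<bar>"
          by (simp add: mult_right_mono)
        also have "\<dots> < e"
          using * by (simp add: pos_less_divide_eq mult.commute)
        finally show "\<bar>a * h x - a * h y\<bar> < e" .
      qed
    qed
    ultimately show ?thesis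
      by (simp add: in_Ub_iff)
  qed
  have add: "\<mu> (\<lambda>x. h x + k x) = \<mu> h + \<mu> k" if "h \<in> Ub U" "k \<in> Ub U" for h k
    using assms(1) that by (simp add: M_def)
  have mult: "\<mu> (\<lambda>x. a * h x) = a * \<mu> h" if "h \<in> Ub U" for a h
    using assms(1) that by (simp add: M_def)
  have "\<mu> (\<lambda>x. c * f x + (- c) * g x) = c * \<mu> f + (- c) * \<mu> g"
    using add[OF scale[OF assms(2), of c] scale[OF assms(3), of "- c"]]
      mult[OF assms(2), of c] mult[OF assms(3), of "- c"] by simp
  then show ?thesis
    by (simp add: algebra_simps)
qed

section \<open>Sequential continuity on the Lipschitz functions of a separable pseudometric\<close>

text \<open>This is the usual \<open>\<epsilon>/3\<close> argument for equicontinuous families.\<close>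

lemma Lip_tendsto_if_tendsto_on_dense:
  assumes d: "pseudometric d"
    and dense: "\<And>x e. e > 0 \<Longrightarrow> \<exists>c\<in>C. d x c < e"
    and f: "f \<in> Lip d" and g: "\<And>n. g n \<in> Lip d"
    and lim: "\<And>c. c \<in> C \<Longrightarrow> (\<lambda>n. g n c) \<longlonglongrightarrow> f c"
  shows "(\<lambda>n. g n x) \<longlonglongrightarrow> f x"
proof (rule tendstoI)
  fix e :: real assume "e > 0"
  then obtain c where c: "c \<in> C" "d x c < e / 3"
    using dense[of "e / 3"] by auto
  have "eventually (\<lambda>n. dist (g n c) (f c) < e / 3) sequentially"
    using lim[OF c(1)] \<open>e > 0\<close> by (intro tendstoD) auto
  then show "eventually (\<lambda>n. dist (g n x) (f x) < e) sequentially"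
  proof eventually_elim
    case (elim n)
    have "\<bar>f x - f c\<bar> \<le> d x c" "\<bar>g n x - g n c\<bar> \<le> d x c"
      using f g[of n] by (auto simp: Lip_def)
    then show ?case
      using elim c(2) unfolding dist_real_def by linarith
  qed
qed

lemma continuous_on_Lip_if_sequentially_continuous:
  fixes \<mu> :: "('a \<Rightarrow> real) \<Rightarrow> real"
  assumes sep: "separable_pseudometric d"
    and seq: "\<And>f g. f \<in> Lip d \<Longrightarrow> (\<And>n. g n \<in> Lip d) \<Longrightarrow> (\<And>x. (\<lambda>n. g n x) \<longlonglongrightarrow> f x)
                \<Longrightarrow> (\<lambda>n. \<mu> (g n)) \<longlonglongrightarrow> \<mu> f"
  shows "continuous_on (Lip d) \<mu>"
proof -
  have d: "pseudometric d"
    using sep by (simp add: separable_pseudometric_def)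
  obtain C where "countable C" and dense: "\<And>x e. e > 0 \<Longrightarrow> \<exists>c\<in>C. d x c < e"
    using sep unfolding separable_pseudometric_iff[OF d] by blast
  moreover have "C \<noteq> {}"
    using dense[of 1] by auto
  ultimately obtain c :: "nat \<Rightarrow> 'a" where c: "range c = C"
    by (metis range_from_nat_into)
  show ?thesis
    unfolding continuous_on_def
  proof (intro ballI tendstoI)
    fix f and e :: real
    assume f: "f \<in> Lip d" and "e > 0"
    \<comment> \<open>The sets \<open>V n\<close> form a neighbourhood base at \<open>f\<close> for the topology of pointwise convergence
      on the dense set.\<close>
    define V where "V n = {g. \<forall>i\<in>{..n}. \<bar>g (c i) - f (c i)\<bar> < inverse (real (Suc n))}" for n
    have "open (V n)" for n
    proof -
      have "V n = (\<Inter>i\<in>{..n}. {g. \<bar>g (c i) - f (c i)\<bar> < inverse (real (Suc n))})"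
        by (auto simp: V_def)
      also have "open \<dots>"
        by (intro open_INT ballI finite_atMost open_Collect_less continuous_intros
            continuous_on_product_coordinates)
      finally show ?thesis .
    qed
    moreover have "f \<in> V n" for n
      by (simp add: V_def)
    moreover have "\<exists>n. \<forall>g\<in>V n. g \<in> Lip d \<longrightarrow> dist (\<mu> g) (\<mu> f) < e"
    proof (rule ccontr)
      assume "\<nexists>n. \<forall>g\<in>V n. g \<in> Lip d \<longrightarrow> dist (\<mu> g) (\<mu> f) < e"
      then obtain g where g: "\<And>n. g n \<in> V n" "\<And>n. g n \<in> Lip d" "\<And>n. \<not> dist (\<mu> (g n)) (\<mu> f) < e"
        by metis
      have lim_c: "(\<lambda>n. g n (c i)) \<longlonglongrightarrow> f (c i)" for i
      proof -
        have "eventually (\<lambda>n. norm (g n (c i) - f (c i)) \<le> inverse (real (Suc n))) sequentially"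
          using eventually_ge_at_top[of i]
        proof eventually_elim
          case (elim n)
          then show ?case
            using g(1)[of n] by (auto simp: V_def less_imp_le)
        qed
        then have "(\<lambda>n. g n (c i) - f (c i)) \<longlonglongrightarrow> 0"
          by (rule Lim_null_comparison[OF _ LIMSEQ_inverse_real_of_nat])
        then show ?thesis
          by (simp add: LIM_zero_iff)
      qed
      have "(\<lambda>n. g n x) \<longlonglongrightarrow> f x" for x
      proof (rule Lip_tendsto_if_tendsto_on_dense[OF d dense f g(2)])
        fix y assume "y \<in> C"
        then obtain i where "y = c i"
          using c by blast
        then show "(\<lambda>n. g n y) \<longlonglongrightarrow> f y"
          using lim_c[of i] by simp
      qed
      then have "(\<lambda>n. \<mu> (g n)) \<longlonglongrightarrow> \<mu> f"
        by (rule seq[OF f g(2)])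
      then have "eventually (\<lambda>n. dist (\<mu> (g n)) (\<mu> f) < e) sequentially"
        using \<open>e > 0\<close> by (rule tendstoD)
      then show False
        using g(3) by simp
    qed
    ultimately show "eventually (\<lambda>g. dist (\<mu> g) (\<mu> f) < e) (at f within Lip d)"
      unfolding eventually_at_topological by meson
  qed
qed

lemma M_u\<sigma>_subset_M_u_separable_modification:
  "M_u\<sigma> U \<subseteq> M_u (separable_modification U)"
proof
  fix \<mu> assume \<mu>: "\<mu> \<in> M_u\<sigma> U"
  then have M: "\<mu> \<in> M U"
    by (simp add: M_u\<sigma>_def)
  have "continuous_on (Lip d) \<mu>" if "ucp (separable_modification U) d" for d
  proof (rule continuous_on_Lip_if_sequentially_continuous)
    show "separable_pseudometric d"
      using that by (simp add: ucp_separable_modification_iff)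
    have ucp: "ucp U d"
      using that by (simp add: ucp_separable_modification_iff)
    fix f g
    assume f: "f \<in> Lip d" and g: "\<And>n. g n \<in> Lip d" and lim: "\<And>x. (\<lambda>n. g n x) \<longlonglongrightarrow> f x"
    \<comment> \<open>The factor \<open>1/2\<close> keeps the differences in \<open>Lip d\<close>.\<close>
    have "(\<lambda>x. 1/2 * (g n x - f x)) \<in> Lip d" for n
      unfolding Lip_def mem_Collect_eq
    proof (intro conjI allI)
      fix x y
      have b: "\<bar>f x\<bar> \<le> 1" "\<bar>g n x\<bar> \<le> 1" "\<bar>f x - f y\<bar> \<le> d x y" "\<bar>g n x - g n y\<bar> \<le> d x y"
        using f g[of n] by (auto simp: Lip_def)
      show "\<bar>1/2 * (g n x - f x)\<bar> \<le> 1"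
        using b(1,2) unfolding abs_le_iff by (simp add: field_simps)
      show "\<bar>1/2 * (g n x - f x) - 1/2 * (g n y - f y)\<bar> \<le> d x y"
        using b(3,4) unfolding abs_le_iff by (simp add: field_simps)
    qed
    moreover have "(\<lambda>n. 1/2 * (g n x - f x)) \<longlonglongrightarrow> 0" for x
      by (rule tendsto_mult_right_zero[OF LIM_zero[OF lim]])
    ultimately have "(\<lambda>n. \<mu> (\<lambda>x. 1/2 * (g n x - f x))) \<longlonglongrightarrow> 0"
      using \<mu> ucp by (simp add: M_u\<sigma>_def)
    moreover have "\<mu> (\<lambda>x. 1/2 * (g n x - f x)) = 1/2 * (\<mu> (g n) - \<mu> f)" for n
      using M f g Lip_subset_Ub[OF ucp] by (intro M_scaled_diff) auto
    ultimately have "(\<lambda>n. 1/2 * (\<mu> (g n) - \<mu> f)) \<longlonglongrightarrow> 0"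
      by (simp only:)
    from tendsto_mult_right_zero[OF this, of 2] show "(\<lambda>n. \<mu> (g n)) \<longlonglongrightarrow> \<mu> f"
      by (simp add: LIM_zero_iff)
  qed
  then show "\<mu> \<in> M_u (separable_modification U)"
    using M by (simp add: M_u_def M_separable_modification)
qed

section \<open>The separable pseudometric of a null sequence of functions\<close>

lemma
  fixes f :: "nat \<Rightarrow> 'a \<Rightarrow> real"
  assumes bound: "\<And>n x. \<bar>f n x\<bar> \<le> 1"
  shows abs_diff_le_sup_diff: "\<bar>f n x - f n y\<bar> \<le> (SUP n. \<bar>f n x - f n y\<bar>)"
    and pseudometric_sup_diff: "pseudometric (\<lambda>x y. SUP n. \<bar>f n x - f n y\<bar>)"
proof -
  have "\<bar>f n x - f n y\<bar> \<le> 2" for n x y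
    using bound[of n x] bound[of n y] by linarith
  then have bdd: "bdd_above (range (\<lambda>n. \<bar>f n x - f n y\<bar>))" for x y
    by (intro bdd_aboveI2)
  have upper: "\<bar>f n x - f n y\<bar> \<le> (SUP n. \<bar>f n x - f n y\<bar>)" for n x y
    by (rule cSUP_upper[OF _ bdd]) simp
  then show "\<bar>f n x - f n y\<bar> \<le> (SUP n. \<bar>f n x - f n y\<bar>)" .
  show "pseudometric (\<lambda>x y. SUP n. \<bar>f n x - f n y\<bar>)"
    unfolding pseudometric_def
  proof (intro conjI allI)
    fix x y z
    show "0 \<le> (SUP n. \<bar>f n x - f n y\<bar>)"
      using upper[of 0 x y] by linarith
    show "(SUP n. \<bar>f n x - f n x\<bar>) = 0"
      by simp
    show "(SUP n. \<bar>f n x - f n y\<bar>) = (SUP n. \<bar>f n y - f n x\<bar>)"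
      by (simp add: abs_minus_commute)
    show "(SUP n. \<bar>f n x - f n z\<bar>) \<le> (SUP n. \<bar>f n x - f n y\<bar>) + (SUP n. \<bar>f n y - f n z\<bar>)"
    proof (rule cSUP_least)
      show "\<bar>f n x - f n z\<bar> \<le> (SUP n. \<bar>f n x - f n y\<bar>) + (SUP n. \<bar>f n y - f n z\<bar>)" for n
        using upper[of n x y] upper[of n y z] by linarith
    qed simp
  qed
qed

text \<open>This is separability of \<open>c\<^sub>0\<close>: up to \<open>e\<close>, a null sequence is described by the finitely many
  terms that precede its small tail, each rounded to an integer multiple of \<open>e/2\<close>.\<close>

lemma separable_sup_diff:
  fixes f :: "nat \<Rightarrow> 'a \<Rightarrow> real"
  assumes bound: "\<And>n x. \<bar>f n x\<bar> \<le> 1" and lim: "\<And>x. (\<lambda>n. f n x) \<longlonglongrightarrow> 0"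
  shows "separable_pseudometric (\<lambda>x y. SUP n. \<bar>f n x - f n y\<bar>)"
proof (rule separable_pseudometric_if_countable_codes)
  show "pseudometric (\<lambda>x y. SUP n. \<bar>f n x - f n y\<bar>)"
    by (rule pseudometric_sup_diff) (rule bound)
  fix e :: real assume e: "e > 0"
  have "\<exists>N. \<forall>n\<ge>N. \<bar>f n x\<bar> < e / 4" for x
    using LIMSEQ_D[OF lim[of x], of "e / 4"] e by simp
  then obtain N where N: "\<And>x n. n \<ge> N x \<Longrightarrow> \<bar>f n x\<bar> < e / 4"
    by metis
  \<comment> \<open>The length of the list records where the tail begins.\<close>
  define h where "h x = map (\<lambda>n. \<lfloor>f n x / (e / 2)\<rfloor>) [0..<N x]" for x
  have "(SUP n. \<bar>f n x - f n y\<bar>) < e" if eq: "h x = h y" for x y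
  proof -
    have len: "N x = N y"
      using arg_cong[OF eq, of length] by (simp add: h_def)
    have "\<bar>f n x - f n y\<bar> \<le> e / 2" for n
    proof (cases "n < N x")
      case True
      then have "\<lfloor>f n x / (e / 2)\<rfloor> = \<lfloor>f n y / (e / 2)\<rfloor>"
        using eq len by (simp add: h_def)
      then show ?thesis
        using abs_diff_less_if_floor_eq[of "e / 2"] e by fastforce
    next
      case False
      then show ?thesis
        using N[of x n] N[of y n] len by linarith
    qed
    then have "(SUP n. \<bar>f n x - f n y\<bar>) \<le> e / 2"
      by (intro cSUP_least) auto
    then show ?thesis
      using e by linarith
  qed
  then show "\<exists>h :: 'a \<Rightarrow> int list. \<forall>x y. h x = h y \<longrightarrow> (SUP n. \<bar>f n x - f n y\<bar>) < e"
    by blast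
qed

lemma M_u_separable_modification_subset_M_u\<sigma>:
  "M_u (separable_modification U) \<subseteq> M_u\<sigma> U"
proof
  fix \<mu> assume \<mu>: "\<mu> \<in> M_u (separable_modification U)"
  then have M: "\<mu> \<in> M U"
    by (simp add: M_u_def M_separable_modification)
  have "(\<lambda>n. \<mu> (f n)) \<longlonglongrightarrow> 0"
    if d: "ucp U d" and f: "\<And>n::nat. f n \<in> Lip d" and lim: "\<And>x. (\<lambda>n. f n x) \<longlonglongrightarrow> 0" for d f
  proof -
    define s where "s = (\<lambda>x y. SUP n. \<bar>f n x - f n y\<bar>)"
    have bound: "\<bar>f n x\<bar> \<le> 1" and lip: "\<bar>f n x - f n y\<bar> \<le> d x y" for n x y
      using f[of n] by (auto simp: Lip_def)
    have sep: "separable_pseudometric s"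
      unfolding s_def using bound lim by (rule separable_sup_diff)
    have "s x y \<le> d x y" for x y
      unfolding s_def using lip by (intro cSUP_least) auto
    then have below: "d x y < e \<Longrightarrow> s x y < e" for x y e
      by (rule le_less_trans)
    have "eventually (\<lambda>(x, y). s x y < e) U" if "e > 0" for e
    proof -
      have "eventually (\<lambda>(x, y). d x y < e) U"
        using d that by (simp add: ucp_def)
      then show ?thesis
        by (rule eventually_mono) (use below in auto)
    qed
    then have "ucp (separable_modification U) s"
      using sep unfolding ucp_separable_modification_iff
      by (auto simp: ucp_def separable_pseudometric_def)
    then have cont: "continuous_on (Lip s) \<mu>"
      using \<mu> by (simp add: M_u_def)
    have f_s: "f n \<in> Lip s" for n
      using bound abs_diff_le_sup_diff[of f, OF bound] by (simp add: Lip_def s_def)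
    have zero_s: "(\<lambda>x. 0) \<in> Lip s"
      using sep by (simp add: Lip_def separable_pseudometric_def pseudometric_def)
    have "f \<longlonglongrightarrow> (\<lambda>x. 0)"
      using lim limitin_componentwise[of "\<lambda>_. euclidean" UNIV f "\<lambda>x. 0" sequentially]
      by (simp add: euclidean_product_topology)
    then have "(\<lambda>n. \<mu> (f n)) \<longlonglongrightarrow> \<mu> (\<lambda>x. 0)"
      using f_s by (intro continuous_on_tendsto_compose[OF cont _ zero_s]) auto
    moreover have "(\<lambda>x. 0) \<in> Ub U"
      by (simp add: in_Ub_iff case_prod_unfold)
    then have "\<mu> (\<lambda>x. 0) = 0"
      using M_scaled_diff[OF M, of "\<lambda>x. 0" "\<lambda>x. 0" 0] by simp
    ultimately show ?thesis
      by simp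
  qed
  then show "\<mu> \<in> M_u\<sigma> U"
    using M by (simp add: M_u\<sigma>_def)
qed

theorem theorem4:
  shows "M_u\<sigma> (uniformity :: ('a::{uniform_space,t2_space} \<times> 'a) filter) =
    M_u (separable_modification uniformity)"
  by (intro equalityI M_u\<sigma>_subset_M_u_separable_modification
      M_u_separable_modification_subset_M_u\<sigma>)

end
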